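(* Let $H\subset S^1$ be a Baire measurable set (i.e. a set with the property of Baire in $S^1$) that is rigid for an uncountable set $C\subset(0,\infty)$. Then for each of the four quarter arcs $Q$ of $S^1$ determined by the points $(0,\pm1)$ and $(\pm1,0)$, either $H\cap Q$ is meagre or $Q\setminus H$ is meagre.
   Context: $S^1\subset\mathbb{R}^2$ is the unit circle centred at the origin. For an angle $\alpha$, $\varrho_\alpha$ denotes the rotation about the origin by angle $\alpha$. For $c>0$, $\psi_c:S^1\to S^1$ is defined by $\psi_c((x,y))=\frac{(x,cy)}{|(x,cy)|}$. A set $H\subset S^1$ that is symmetric about the origin ($H=-H$) is called rigid for a set $C\subset(0,\infty)$ if for every $c\in C$ there is an angle $\alpha$ such that $H=\varrho_\alpha(\psi_c(H))$. A set has the property of Baire if it differs from an open set by a meagre (first category) set. *)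

theory Defs
  imports "HOL-Analysis.Analysis"
begin

definition nowhere_dense_in :: "'a topology \<Rightarrow> 'a set \<Rightarrow> bool" where
  "nowhere_dense_in X S \<longleftrightarrow> S \<subseteq> topspace X \<and> X interior_of (X closure_of S) = {}"

definition meagre_in :: "'a topology \<Rightarrow> 'a set \<Rightarrow> bool" where
  "meagre_in X S \<longleftrightarrow>
     (\<exists>\<N>. countable \<N> \<and> (\<forall>N\<in>\<N>. nowhere_dense_in X N) \<and> S = \<Union>\<N>)"

definition Baire_property_in :: "'a topology \<Rightarrow> 'a set \<Rightarrow> bool" where
  "Baire_property_in X S \<longleftrightarrow>
     S \<subseteq> topspace X \<and> (\<exists>U. openin X U \<and> meagre_in X (sym_diff S U))"

text \<open>The plane is the product type, whose norm is the Euclidean one.\<close>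

abbreviation unit_circle :: "(real \<times> real) set" where
  "unit_circle \<equiv> sphere 0 1"

definition rotation :: "real \<Rightarrow> real \<times> real \<Rightarrow> real \<times> real" where
  "rotation \<alpha> = (\<lambda>(x, y). (cos \<alpha> * x - sin \<alpha> * y, sin \<alpha> * x + cos \<alpha> * y))"

definition psi :: "real \<Rightarrow> real \<times> real \<Rightarrow> real \<times> real" where
  "psi c = (\<lambda>(x, y). (x, c * y) /\<^sub>R norm (x, c * y))"

definition rigid_for :: "(real \<times> real) set \<Rightarrow> real set \<Rightarrow> bool" where
  "rigid_for H C \<longleftrightarrow>
     H \<subseteq> unit_circle \<and> H = uminus ` H \<and> C \<subseteq> {0<..} \<and>
     (\<forall>c\<in>C. \<exists>\<alpha>. H = rotation \<alpha> ` (psi c ` H))"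

text \<open>The signs \<open>s\<close> and \<open>t\<close> select the quadrant. The arcs contain their endpoints, which
  does not matter for statements up to meagre sets.\<close>

definition quarter_arcs :: "(real \<times> real) set set" where
  "quarter_arcs =
     {{(x, y). (x, y) \<in> unit_circle \<and> 0 \<le> s * x \<and> 0 \<le> t * y} | s t.
        s \<in> {-1, 1} \<and> t \<in> {-1, 1}}"

end

theory Submission
  imports Defs
begin

text \<open>Let \<open>W\<close> be the largest open subset of the circle in which \<open>H\<close> is comeagre; it differs from \<open>H\<close>
  by a meagre set, and every self-homeomorphism of the circle that preserves \<open>H\<close> preserves \<open>W\<close>. So for
  \<open>c \<in> C\<close> the map \<open>\<rho>\<^sub>\<alpha> \<circ> \<psi>\<^sub>c\<close> permutes the components of \<open>W\<close>. There are countably many of them and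
  each has finitely many boundary points, so for boundary points \<open>p\<close>, \<open>q\<close> of one component the inner
  product of \<open>\<psi>\<^sub>c(p)\<close> and \<open>\<psi>\<^sub>c(q)\<close> takes only countably many values, and some value is taken for
  uncountably many \<open>c\<close>. This forces \<open>p = \<plusminus>q\<close> or both points to lie on the coordinate axes. If the
  second case always occurs, an open quarter arc meeting the component is contained in it. In the
  first case the component has boundary \<open>{p}\<close> or \<open>{p, -p}\<close>, and by symmetry \<open>W\<close> is the circle up to
  finitely many points.\<close>

section \<open>Meagre sets and homeomorphisms\<close>

lemma meagre_in_subset:
  assumes "meagre_in X S" "T \<subseteq> S"
  shows "meagre_in X T"
proof -
  obtain \<N> where N: "countable \<N>" "\<forall>N\<in>\<N>. nowhere_dense_in X N" "S = \<Union>\<N>"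
    using assms(1) unfolding meagre_in_def by blast
  have "nowhere_dense_in X (N \<inter> T)" if "N \<in> \<N>" for N
  proof -
    have "X interior_of (X closure_of (N \<inter> T)) \<subseteq> X interior_of (X closure_of N)"
      by (intro interior_of_mono closure_of_mono) auto
    then show ?thesis using N(2) that unfolding nowhere_dense_in_def by blast
  qed
  moreover have "T = \<Union>((\<lambda>N. N \<inter> T) ` \<N>)" using N(3) assms(2) by auto
  ultimately show ?thesis unfolding meagre_in_def
    using N(1) by (intro exI[of _ "(\<lambda>N. N \<inter> T) ` \<N>"]) auto
qed

lemma meagre_in_UNION:
  assumes "countable I" "\<And>i. i \<in> I \<Longrightarrow> meagre_in X (S i)"
  shows "meagre_in X (\<Union>i\<in>I. S i)"
proof -
  have "\<forall>i\<in>I. \<exists>\<N>. countable \<N> \<and> (\<forall>N\<in>\<N>. nowhere_dense_in X N) \<and> S i = \<Union>\<N>"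
    using assms(2) unfolding meagre_in_def by blast
  then obtain \<N> where N: "\<And>i. i \<in> I \<Longrightarrow> countable (\<N> i)"
      "\<And>i N. i \<in> I \<Longrightarrow> N \<in> \<N> i \<Longrightarrow> nowhere_dense_in X N"
      "\<And>i. i \<in> I \<Longrightarrow> S i = \<Union>(\<N> i)"
    by metis
  have "countable (\<Union>i\<in>I. \<N> i)" using assms(1) N(1) by blast
  moreover have "(\<Union>i\<in>I. S i) = \<Union>(\<Union>i\<in>I. \<N> i)" using N(3) by fastforce
  ultimately show ?thesis unfolding meagre_in_def using N(2) by (intro exI[of _ "\<Union>i\<in>I. \<N> i"]) auto
qed

lemma meagre_in_Un:
  assumes "meagre_in X S" "meagre_in X T"
  shows "meagre_in X (S \<union> T)"
proof -
  have "meagre_in X (\<Union>A\<in>{S, T}. A)" using assms by (intro meagre_in_UNION) auto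
  then show ?thesis by simp
qed

lemma meagre_in_homeomorphic_image:
  assumes "homeomorphic_map X Y g" "meagre_in X S"
  shows "meagre_in Y (g ` S)"
proof -
  obtain \<N> where N: "countable \<N>" "\<forall>N\<in>\<N>. nowhere_dense_in X N" "S = \<Union>\<N>"
    using assms(2) unfolding meagre_in_def by blast
  have "nowhere_dense_in Y (g ` N)" if "N \<in> \<N>" for N
  proof -
    have N': "N \<subseteq> topspace X" "X interior_of (X closure_of N) = {}"
      using N(2) that unfolding nowhere_dense_in_def by auto
    have "g ` N \<subseteq> topspace Y"
      using N'(1) homeomorphic_imp_surjective_map[OF assms(1)] by blast
    then show ?thesis
      unfolding nowhere_dense_in_def
      using N' homeomorphic_map_closure_of[OF assms(1) N'(1)]
        homeomorphic_map_interior_of[OF assms(1) closure_of_subset_topspace[of X N]] by auto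
  qed
  moreover have "g ` S = \<Union>((`) g ` \<N>)" using N(3) by auto
  ultimately show ?thesis unfolding meagre_in_def
    using N(1) by (intro exI[of _ "(`) g ` \<N>"]) auto
qed

section \<open>The open part of a set modulo meagre sets\<close>

definition open_core :: "'a topology \<Rightarrow> 'a set \<Rightarrow> 'a set" where
  "open_core X H = \<Union>{V. openin X V \<and> meagre_in X (V - H)}"

lemma openin_open_core: "openin X (open_core X H)"
  unfolding open_core_def by auto

text \<open>The union defining the core may be uncountable, but by the Lindelof property countably
  many of its members already cover it.\<close>

lemma meagre_open_core_diff:
  fixes S :: "'a::second_countable_topology set"
  shows "meagre_in (top_of_set S) (open_core (top_of_set S) H - H)"
proof -
  let ?F = "{V. openin (top_of_set S) V \<and> meagre_in (top_of_set S) (V - H)}"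
  obtain F where F: "F \<subseteq> ?F" "countable F" "\<Union>F = \<Union>?F"
    using Lindelof_openin[of ?F S] by blast
  have "meagre_in (top_of_set S) (\<Union>V\<in>F. V - H)"
    using F by (intro meagre_in_UNION) auto
  moreover have "open_core (top_of_set S) H - H = (\<Union>V\<in>F. V - H)"
    unfolding open_core_def F(3)[symmetric] by auto
  ultimately show ?thesis by simp
qed

text \<open>An open set witnessing the property of Baire is itself one of the sets whose union is
  the core.\<close>

lemma meagre_diff_open_core:
  assumes "Baire_property_in X H"
  shows "meagre_in X (H - open_core X H)"
proof -
  obtain U where U: "openin X U" "meagre_in X (sym_diff H U)"
    using assms unfolding Baire_property_in_def by blast
  have "meagre_in X (U - H)" using U(2) by (rule meagre_in_subset) auto
  then have "U \<subseteq> open_core X H" unfolding open_core_def using U(1) by blast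
  then show ?thesis using U(2) by (elim meagre_in_subset) auto
qed

text \<open>A map fixing \<open>H\<close> carries each open set of the defining union to another
  one, which gives one inclusion. The inverse map also fixes \<open>H\<close> and gives the
  other.\<close>

lemma open_core_invariant:
  assumes "homeomorphic_map X X g" "H \<subseteq> topspace X" "g ` H = H"
  shows "g ` open_core X H = open_core X H"
proof -
  have sub: "f ` open_core X H \<subseteq> open_core X H"
    if f: "homeomorphic_map X X f" "f ` H = H" for f
  proof -
    have "f ` V \<subseteq> open_core X H" if V: "openin X V" "meagre_in X (V - H)" for V
    proof -
      have "inj_on f (topspace X)" using f(1) homeomorphic_imp_injective_map by blast
      then have "f ` (V - H) = f ` V - H"
        using inj_on_image_set_diff[of f "topspace X" V H] openin_subset[OF V(1)] assms(2) f(2)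
        by auto
      moreover have "meagre_in X (f ` (V - H))"
        using meagre_in_homeomorphic_image[OF f(1) V(2)] .
      moreover have "openin X (f ` V)"
        using homeomorphic_map_openness[OF f(1) openin_subset[OF V(1)]] V(1) by blast
      ultimately show ?thesis unfolding open_core_def by auto
    qed
    then show ?thesis unfolding open_core_def by blast
  qed
  obtain h where h: "homeomorphic_maps X X g h"
    using assms(1) homeomorphic_map_maps by blast
  then have hm: "homeomorphic_map X X h"
    and hg: "\<And>x. x \<in> topspace X \<Longrightarrow> h (g x) = x" and gh: "\<And>x. x \<in> topspace X \<Longrightarrow> g (h x) = x"
    by (auto simp: homeomorphic_maps_map)
  have "h ` H = h ` g ` H" using assms(3) by simp
  also have "\<dots> = H" using hg assms(2) by (force simp: image_image)
  finally have "h ` open_core X H \<subseteq> open_core X H" using sub[OF hm] by simp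
  moreover have "g ` h ` open_core X H = open_core X H"
    using gh openin_subset[OF openin_open_core[of X H]] by (force simp: image_image)
  ultimately have "open_core X H \<subseteq> g ` open_core X H" by (metis image_mono)
  then show ?thesis using sub[OF assms(1,3)] by blast
qed

section \<open>Homeomorphisms, components and their boundary points\<close>

lemma homeomorphism_imp_homeomorphic_map:
  assumes "homeomorphism S T f g"
  shows "homeomorphic_map (top_of_set S) (top_of_set T) f"
  unfolding homeomorphic_map_maps homeomorphic_maps_def
  using assms unfolding homeomorphism_def
  by (intro exI[of _ g]) auto

text \<open>The image of \<open>I\<close> lies in some component \<open>J\<close>. Pulling
  \<open>J\<close> back yields a connected subset of \<open>U\<close> containing \<open>I\<close>,
  so maximality of \<open>I\<close> forces equality.\<close>

lemma components_homeomorphic_image: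
  assumes "homeomorphism S S f g" "U \<subseteq> S" "f ` U = U" "I \<in> components U"
  shows "f ` I \<in> components U"
proof -
  have I: "I \<subseteq> U" "I \<noteq> {}" "connected I"
    using assms(4) in_components_subset in_components_nonempty in_components_connected by blast+
  have gU: "g ` U = U"
  proof -
    have "g ` U = g ` f ` U" using assms(3) by simp
    also have "\<dots> = U"
      using homeomorphism_apply1[OF assms(1)] assms(2) by (force simp: image_image)
    finally show ?thesis .
  qed
  have cf: "continuous_on U f"
    using homeomorphism_cont1[OF assms(1)] assms(2) continuous_on_subset by blast
  have cg: "continuous_on U g"
    using homeomorphism_cont2[OF assms(1)] assms(2) continuous_on_subset by blast
  have "connected (f ` I)"
    using I cf by (meson connected_continuous_image continuous_on_subset)
  moreover have "f ` I \<subseteq> U" using I(1) assms(3) by blast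
  ultimately obtain J where J: "J \<in> components U" "f ` I \<subseteq> J"
    using I(2) exists_component_superset[of "f ` I" U] by blast
  have JU: "J \<subseteq> U" using J(1) in_components_subset by blast
  have cJ: "connected (g ` J)"
    using J(1) JU cg in_components_connected
    by (meson connected_continuous_image continuous_on_subset)
  have "I = g ` f ` I"
    using homeomorphism_apply1[OF assms(1)] assms(2) I(1) by (force simp: image_image)
  then have "I \<subseteq> g ` J" using J(2) by blast
  then have "g ` J \<subseteq> I"
    using components_maximal[OF assms(4) cJ] gU JU I(2) by blast
  then have "f ` g ` J \<subseteq> f ` I" by blast
  moreover have "f ` g ` J = J"
    using homeomorphism_apply2[OF assms(1)] assms(2) JU by (force simp: image_image)
  ultimately show ?thesis using J by auto
qed

text \<open>Components are open in \<open>S\<close> by local connectedness, so a countable subfamily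
  has the same union. Being disjoint and nonempty, none can be missing from it.\<close>

lemma countable_components_openin:
  fixes S :: "'a::second_countable_topology set"
  assumes "locally connected S" "openin (top_of_set S) U"
  shows "countable (components U)"
proof -
  have op: "openin (top_of_set S) I" if "I \<in> components U" for I
    using openin_components_locally_connected assms that openin_trans locally_open_subset by metis
  obtain F where F: "F \<subseteq> components U" "countable F" "\<Union>F = \<Union>(components U)"
    using Lindelof_openin[of "components U" S] op by blast
  have "components U \<subseteq> F"
  proof
    fix I assume I: "I \<in> components U"
    then obtain x where x: "x \<in> I" using in_components_nonempty by blast
    then obtain J where J: "J \<in> F" "x \<in> J" using F(3) I by blast
    then have "I = J" using I F(1) x components_eq[of I U J] by blast
    then show "I \<in> F" using J by simp
  qed
  then show ?thesis using F(2) countable_subset by blast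
qed

text \<open>Without boundary points of \<open>I\<close> in \<open>T\<close>, the set
  \<open>T \<inter> I\<close> equals \<open>T \<inter> closure I\<close> and is therefore clopen in
  the connected set \<open>T\<close>.\<close>

lemma connected_subset_of_disjoint_boundary:
  assumes "openin (top_of_set S) I" "T \<subseteq> S" "connected T" "T \<inter> I \<noteq> {}"
    and "T \<inter> (closure I - I) = {}"
  shows "T \<subseteq> I"
proof -
  have "openin (top_of_set T) (T \<inter> I)"
    using assms(1,2) by (auto simp: openin_open)
  moreover have "T \<inter> I = T \<inter> closure I"
    using assms(5) closure_subset by blast
  then have "closedin (top_of_set T) (T \<inter> I)"
    by (metis closed_closure closedin_closed_Int)
  ultimately show ?thesis using assms(3,4) connected_clopen by blast
qed

lemma closure_diff_homeomorphic_image: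
  assumes "homeomorphism S S f g" "closed S" "I \<subseteq> S" "p \<in> closure I - I"
  shows "f p \<in> closure (f ` I) - f ` I"
proof -
  have sub: "closure I \<subseteq> S" using assms(2,3) closure_minimal by blast
  have "f ` closure I \<subseteq> closure (f ` I)"
    using assms(1) sub by (intro image_closure_subset)
      (auto simp: homeomorphism_def closure_subset intro: continuous_on_subset)
  moreover have "f p \<notin> f ` I"
    using homeomorphism_apply1[OF assms(1)] assms(3,4) sub by (metis DiffD1 DiffD2 imageE subsetD)
  ultimately show ?thesis using assms(4) by blast
qed

section \<open>Chords and boundary points of arcs\<close>

lemma pair_in_unit_circle: "(x, y) \<in> unit_circle \<longleftrightarrow> x\<^sup>2 + y\<^sup>2 = 1" for x y :: real
  by (simp add: norm_Pair)

text \<open>Twice the signed area of the triangle \<open>p\<close>, \<open>q\<close>,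
  \<open>x\<close>. It vanishes when the points are collinear, and for distinct \<open>p\<close> and
  \<open>q\<close> its sign tells on which side of the line through them \<open>x\<close>
  lies.\<close>

definition area :: "real \<times> real \<Rightarrow> real \<times> real \<Rightarrow> real \<times> real \<Rightarrow> real" where
  "area p q x = (fst q - fst p) * (snd x - snd p) - (snd q - snd p) * (fst x - fst p)"

text \<open>A line meets the circle in at most two points. The chord vectors
  \<open>d = q - p\<close> and \<open>e = x - p\<close> are parallel, and the circle equation makes
  their squared lengths linear in them.\<close>

lemma unit_circle_collinear:
  assumes "p \<in> unit_circle" "q \<in> unit_circle" "x \<in> unit_circle" "p \<noteq> q" "area p q x = 0"
  shows "x = p \<or> x = q"
proof -
  obtain a b where p: "p = (a, b)" by (cases p)
  define d1 d2 e1 e2 where de: "d1 = fst q - a" "d2 = snd q - b" "e1 = fst x - a" "e2 = snd x - b"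
  have q: "q = (a + d1, b + d2)" and x: "x = (a + e1, b + e2)"
    unfolding de by (simp_all add: prod_eq_iff)
  have n: "a\<^sup>2 + b\<^sup>2 = 1" "(a + d1)\<^sup>2 + (b + d2)\<^sup>2 = 1" "(a + e1)\<^sup>2 + (b + e2)\<^sup>2 = 1"
    using assms(1-3) unfolding p q x pair_in_unit_circle by auto
  have dd: "d1\<^sup>2 + d2\<^sup>2 = - 2 * (a * d1 + b * d2)" and ee: "e1\<^sup>2 + e2\<^sup>2 = - 2 * (a * e1 + b * e2)"
    using n by (simp_all add: power2_eq_square algebra_simps)
  have par: "d1 * e2 = d2 * e1"
    using assms(5) unfolding area_def p q x by simp
  define E D where ED: "E = e1\<^sup>2 + e2\<^sup>2" "D = d1\<^sup>2 + d2\<^sup>2"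
  have D0: "D \<noteq> 0"
    using assms(4) unfolding p q ED by (auto simp: sum_power2_eq_zero_iff)
  have "(a * e1 + b * e2) * d1 = (a * d1 + b * d2) * e1"
    "(a * e1 + b * e2) * d2 = (a * d1 + b * d2) * e2"
    using par by algebra+
  then have 1: "E * d1 = D * e1" "E * d2 = D * e2"
    unfolding ED dd ee by algebra+
  \<comment> \<open>The vector identity \<open>E d = D e\<close> is paired with \<open>d\<close>
    here and with \<open>e\<close> below. Together this gives \<open>E * E = D * E\<close>, hence
    \<open>E = 0\<close> or \<open>E = D\<close>.\<close>
  have "E * D = D * (d1 * e1 + d2 * e2)"
  proof -
    have "E * D = (E * d1) * d1 + (E * d2) * d2" by (simp add: ED power2_eq_square algebra_simps)
    also have "\<dots> = D * (d1 * e1 + d2 * e2)" unfolding 1 by (simp add: algebra_simps)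
    finally show ?thesis .
  qed
  then have 2: "E = d1 * e1 + d2 * e2" using D0 by simp
  have "E * (d1 * e1 + d2 * e2) = D * E"
  proof -
    have "E * (d1 * e1 + d2 * e2) = (E * d1) * e1 + (E * d2) * e2" by (simp add: algebra_simps)
    also have "\<dots> = D * E" unfolding 1 by (simp add: ED power2_eq_square algebra_simps)
    finally show ?thesis .
  qed
  then have "E = 0 \<or> E = D" using 2 by auto
  then show ?thesis
  proof
    assume "E = 0"
    then show ?thesis unfolding ED x p by (simp add: sum_power2_eq_zero_iff)
  next
    assume "E = D"
    then have "d1 = e1" "d2 = e2" using 1 D0 by auto
    then show ?thesis unfolding x q by simp
  qed
qed

lemma continuous_on_area: "continuous_on A (area p q)"
  unfolding area_def by (intro continuous_intros)

text \<open>The line through \<open>p\<close> and \<open>q\<close> meets the circle only in these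
  two points, so it misses \<open>J\<close> and \<open>area p q\<close> keeps one sign on
  \<open>J\<close> by connectedness. The sign passes to the closure weakly, and strictly at
  \<open>r\<close> since \<open>r\<close> is off the line.\<close>

lemma area_same_side:
  assumes J: "connected J" "J \<subseteq> unit_circle" "x \<in> J"
    and pqr: "p \<in> unit_circle" "q \<in> unit_circle" "r \<in> unit_circle" "p \<noteq> q" "r \<noteq> p" "r \<noteq> q"
    and out: "p \<notin> J" "q \<notin> J" and r: "r \<in> closure J"
  shows "0 < area p q x * area p q r"
proof -
  have nz: "area p q y \<noteq> 0" if "y \<in> J" for y
    using unit_circle_collinear[of p q y] pqr J(2) out that by blast
  have con: "connected (area p q ` J)"
    using J(1) continuous_on_area by (rule connected_continuous_image[rotated])
  have side: "0 < area p q x * area p q y" if "y \<in> J" for y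
  proof (rule ccontr)
    assume "\<not> 0 < area p q x * area p q y"
    then have "area p q x < 0 \<and> 0 < area p q y \<or> area p q y < 0 \<and> 0 < area p q x"
      using nz[OF that] nz[OF J(3)] by (auto simp: zero_less_mult_iff)
    then have "0 \<in> area p q ` J"
      using connectedD_interval[OF con, of "area p q x" "area p q y" 0]
        connectedD_interval[OF con, of "area p q y" "area p q x" 0] that J(3) by auto
    then show False using nz by auto
  qed
  have "closed {y. 0 \<le> area p q x * area p q y}"
    by (intro closed_Collect_le continuous_intros continuous_on_area)
  then have "closure J \<subseteq> {y. 0 \<le> area p q x * area p q y}"
    using side by (intro closure_minimal) (auto intro: less_imp_le)
  then have "0 \<le> area p q x * area p q r" using r by blast
  moreover have "area p q r \<noteq> 0" using unit_circle_collinear[of p q r] pqr by blast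
  ultimately show ?thesis using nz[OF J(3)] by (simp add: order_less_le)
qed

lemma inner_unit_lt_1:
  fixes p q :: "'a::real_inner"
  assumes "norm p = 1" "norm q = 1" "p \<noteq> q"
  shows "inner p q < 1"
proof -
  have "0 < (norm (p - q))\<^sup>2" using assms(3) by simp
  also have "\<dots> = 2 - 2 * inner p q"
    using assms(1,2) by (simp add: power2_norm_eq_inner inner_diff inner_commute norm_eq_1)
  finally show ?thesis by simp
qed

text \<open>With three boundary points, the arc would lie on the inner side of each chord between
  them, hence inside the triangle that they span, which is inside the open disc.\<close>

lemma finite_boundary_connected_subset_unit_circle:
  assumes J: "connected J" "J \<subseteq> unit_circle"
  shows "finite (closure J - J)"
proof -
  have two: "p = q \<or> q = r \<or> r = p"
    if b: "p \<in> closure J - J" "q \<in> closure J - J" "r \<in> closure J - J" for p q r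
  proof (rule ccontr)
    assume "\<not> ?thesis"
    then have ne: "p \<noteq> q" "q \<noteq> r" "r \<noteq> p" "q \<noteq> p" "r \<noteq> q" "p \<noteq> r" by auto
    have "closure J \<subseteq> unit_circle" using J(2) by (intro closure_minimal) auto
    then have c: "p \<in> unit_circle" "q \<in> unit_circle" "r \<in> unit_circle" using b by auto
    have "J \<noteq> {}" using b(1) by auto
    then obtain x where x: "x \<in> J" by blast
    define D where "D = area p q r"
    \<comment> \<open>These are the barycentric coordinates of \<open>x\<close> in the triangle
      \<open>p\<close>, \<open>q\<close>, \<open>r\<close>, multiplied by \<open>D\<^sup>2\<close>
      to avoid division. Their positivity says that \<open>x\<close> is inside the triangle.\<close>
    define l m n where lmn: "l = area q r x * D" "m = area r p x * D" "n = area p q x * D"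
    have "area q r p = D" "area r p q = D"
      unfolding D_def area_def by (simp_all add: algebra_simps)
    then have pos: "0 < l" "0 < m" "0 < n"
      using area_same_side[OF J x, of q r p] area_same_side[OF J x, of r p q]
        area_same_side[OF J x, of p q r] b c ne unfolding lmn D_def by auto
    have sum: "l + m + n = D\<^sup>2"
      unfolding lmn D_def area_def by (simp add: power2_eq_square algebra_simps)
    have comb: "l *\<^sub>R p + m *\<^sub>R q + n *\<^sub>R r = D\<^sup>2 *\<^sub>R x"
      unfolding lmn D_def area_def prod_eq_iff by (simp add: power2_eq_square algebra_simps)
    have n1: "inner p p = 1" "inner q q = 1" "inner r r = 1" "inner x x = 1"
      using c x J(2) by (auto simp: norm_eq_1)
    have lt: "inner p q < 1" "inner q r < 1" "inner p r < 1"
      using c ne by (auto intro!: inner_unit_lt_1)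
    \<comment> \<open>The squared length of a combination of distinct unit vectors with positive
      weights is strictly below the squared sum of the weights, whereas \<open>x\<close> has length
      one.\<close>
    have "(l + m + n)\<^sup>2 = inner (D\<^sup>2 *\<^sub>R x) (D\<^sup>2 *\<^sub>R x)"
      unfolding sum using n1 by (simp add: power2_eq_square)
    also have "\<dots> = l\<^sup>2 + m\<^sup>2 + n\<^sup>2 + 2 * (l * m * inner p q) + 2 * (m * n * inner q r)
        + 2 * (l * n * inner p r)"
      unfolding comb[symmetric] using n1
      by (simp add: inner_add inner_commute power2_eq_square algebra_simps)
    also have "\<dots> < l\<^sup>2 + m\<^sup>2 + n\<^sup>2 + 2 * (l * m) + 2 * (m * n) + 2 * (l * n)"
    proof -
      have "l * m * inner p q < l * m" "m * n * inner q r < m * n" "l * n * inner p r < l * n"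
        using pos lt by simp_all
      then show ?thesis by linarith
    qed
    also have "\<dots> = (l + m + n)\<^sup>2" by (simp add: power2_eq_square algebra_simps)
    finally show False by simp
  qed
  have "\<exists>a b. closure J - J \<subseteq> {a, b}"
  proof (cases "\<exists>a b. a \<in> closure J - J \<and> b \<in> closure J - J \<and> a \<noteq> b")
    case True
    then show ?thesis using two by (metis insertCI subsetI)
  next
    case False
    then show ?thesis by blast
  qed
  then show ?thesis using finite_subset by blast
qed

section \<open>Rotations and the maps \<open>psi\<close> as homeomorphisms of the circle\<close>

lemma inner_rotation: "inner (rotation \<alpha> x) (rotation \<alpha> y) = inner x y"
proof -
  obtain a b c d where xy: "x = (a, b)" "y = (c, d)" by (cases x, cases y)
  have "cos \<alpha> * cos \<alpha> + sin \<alpha> * sin \<alpha> = 1" by (simp flip: power2_eq_square)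
  moreover have "inner (rotation \<alpha> x) (rotation \<alpha> y)
      = (cos \<alpha> * cos \<alpha> + sin \<alpha> * sin \<alpha>) * (a * c + b * d)"
    unfolding xy rotation_def by (simp add: algebra_simps del: sin_cos_squared_add3)
  ultimately show ?thesis unfolding xy by simp
qed

lemma rotation_minus: "rotation (- \<alpha>) (rotation \<alpha> x) = x"
proof -
  obtain a b where x: "x = (a, b)" by (cases x)
  have *: "cos \<alpha> * (cos \<alpha> * z) + sin \<alpha> * (sin \<alpha> * z) = z" for z
  proof -
    have "cos \<alpha> * (cos \<alpha> * z) + sin \<alpha> * (sin \<alpha> * z) = ((cos \<alpha>)\<^sup>2 + (sin \<alpha>)\<^sup>2) * z"
      by (simp add: power2_eq_square algebra_simps del: sin_cos_squared_add3)
    then show ?thesis by simp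
  qed
  show ?thesis unfolding x rotation_def using *[of a] *[of b] by (simp add: algebra_simps)
qed

lemma homeomorphism_rotation:
  "homeomorphism unit_circle unit_circle (rotation \<alpha>) (rotation (- \<alpha>))"
proof -
  have "continuous_on unit_circle (rotation \<beta>)" for \<beta>
    unfolding rotation_def case_prod_unfold by (intro continuous_intros)
  moreover have "rotation \<beta> x \<in> unit_circle" if "x \<in> unit_circle" for \<beta> x
    using that inner_rotation[of \<beta> x x] by (simp add: norm_eq_1)
  ultimately show ?thesis
    using rotation_minus[of \<alpha>] rotation_minus[of "- \<alpha>"]
    by (intro homeomorphismI) auto
qed

lemma norm_psi_denominator_pos:
  assumes "0 < c" "x \<in> unit_circle"
  shows "0 < norm (fst x, c * snd x)"
proof -
  have "x \<noteq> 0" using assms(2) by auto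
  then show ?thesis using assms(1) by (auto simp: prod_eq_iff zero_prod_def)
qed

lemma psi_in_unit_circle:
  assumes "0 < c" "x \<in> unit_circle"
  shows "psi c x \<in> unit_circle"
proof -
  have "norm (v /\<^sub>R norm v) = 1" if "0 < norm v" for v :: "real \<times> real" using that by simp
  from this[OF norm_psi_denominator_pos[OF assms]] show ?thesis
    by (simp only: psi_def case_prod_unfold mem_sphere_0)
qed

text \<open>The scalar \<open>N\<close> introduced by normalising commutes with the stretching, so
  undoing the stretch leaves \<open>x /\<^sub>R N\<close>, and the second normalisation removes
  \<open>N\<close>.\<close>

lemma psi_inverse:
  assumes "0 < c" "x \<in> unit_circle"
  shows "psi (1 / c) (psi c x) = x"
proof -
  obtain a b where x: "x = (a, b)" by (cases x)
  define N where "N = norm (a, c * b)"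
  have N: "0 < N" using norm_psi_denominator_pos[OF assms] unfolding N_def x by simp
  have "psi c x = (a / N, c * b / N)"
    unfolding psi_def x N_def by (simp add: divide_inverse algebra_simps)
  then have "psi (1 / c) (psi c x) = (a / N, b / N) /\<^sub>R norm (a / N, b / N)"
    unfolding psi_def using assms(1) by simp
  also have "(a / N, b / N) = x /\<^sub>R N" unfolding x by (simp add: divide_inverse algebra_simps)
  finally show ?thesis using N assms(2) by simp
qed

lemma homeomorphism_psi:
  assumes "0 < c"
  shows "homeomorphism unit_circle unit_circle (psi c) (psi (1 / c))"
proof -
  have "continuous_on unit_circle (psi e)" if "0 < e" for e
    unfolding psi_def case_prod_unfold using norm_psi_denominator_pos[OF that]
    by (intro continuous_intros) force
  then show ?thesis
    using assms psi_inverse[of c] psi_inverse[of "1 / c"] psi_in_unit_circle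
    by (intro homeomorphismI) auto
qed

section \<open>Inner products of images under \<open>psi\<close>\<close>

text \<open>Squaring and clearing denominators removes the square roots, so a fixed value of the
  inner product becomes a polynomial condition on \<open>c\<^sup>2\<close>.\<close>

lemma inner_psi_squared:
  assumes "0 < c" "(a, b) \<in> unit_circle" "(e, f) \<in> unit_circle"
  shows "(inner (psi c (a, b)) (psi c (e, f)))\<^sup>2 * ((a\<^sup>2 + c\<^sup>2 * b\<^sup>2) * (e\<^sup>2 + c\<^sup>2 * f\<^sup>2))
    = (a * e + c\<^sup>2 * (b * f))\<^sup>2"
proof -
  define M N where MN: "M = norm (a, c * b)" "N = norm (e, c * f)"
  have pos: "0 < M" "0 < N"
    using norm_psi_denominator_pos[OF assms(1)] assms(2,3) unfolding MN by force+
  have sq: "M\<^sup>2 = a\<^sup>2 + c\<^sup>2 * b\<^sup>2" "N\<^sup>2 = e\<^sup>2 + c\<^sup>2 * f\<^sup>2"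
    unfolding MN by (simp_all add: norm_Pair power_mult_distrib)
  have "inner (psi c (a, b)) (psi c (e, f)) = (a * e + c\<^sup>2 * (b * f)) / (M * N)"
    unfolding psi_def MN by (simp add: divide_inverse power2_eq_square algebra_simps)
  then show ?thesis unfolding sq[symmetric] using pos
    by (simp add: power_divide power_mult_distrib)
qed

text \<open>Constancy of the angle is a quadratic equation in \<open>c\<^sup>2\<close>; all its coefficients vanish.\<close>

lemma inner_psi_constant_cases:
  assumes D: "infinite D" "D \<subseteq> {0<..}" "\<And>c. c \<in> D \<Longrightarrow> inner (psi c p) (psi c q) = K"
    and pq: "p \<in> unit_circle" "q \<in> unit_circle"
  shows "p = q \<or> p = - q \<or> (fst p = 0 \<or> snd p = 0) \<and> (fst q = 0 \<or> snd q = 0)"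
proof -
  obtain a b e f where ab: "p = (a, b)" "q = (e, f)" by (cases p, cases q)
  \<comment> \<open>The right side minus the left side of \<open>inner_psi_squared\<close>, with the
    inner product replaced by \<open>K\<close>, as a polynomial in \<open>c\<^sup>2\<close>.\<close>
  define P where "P = [:(a * e)\<^sup>2 - K\<^sup>2 * (a * e)\<^sup>2,
    2 * (a * e) * (b * f) - K\<^sup>2 * ((a * f)\<^sup>2 + (b * e)\<^sup>2), (b * f)\<^sup>2 - K\<^sup>2 * (b * f)\<^sup>2:]"
  have "poly P (c\<^sup>2) = 0" if "c \<in> D" for c
  proof -
    have "K\<^sup>2 * ((a\<^sup>2 + c\<^sup>2 * b\<^sup>2) * (e\<^sup>2 + c\<^sup>2 * f\<^sup>2)) = (a * e + c\<^sup>2 * (b * f))\<^sup>2"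
      using inner_psi_squared[of c a b e f] D(2) D(3)[OF that] pq that unfolding ab by auto
    then show ?thesis unfolding P_def by (simp add: power2_eq_square algebra_simps)
  qed
  then have "(\<lambda>c. c\<^sup>2) ` D \<subseteq> {t. poly P t = 0}" by auto
  moreover have "inj_on (\<lambda>c. c\<^sup>2) D"
    by (intro inj_onI) (metis D(2) greaterThan_iff less_imp_le power2_eq_iff_nonneg subsetD)
  then have "infinite ((\<lambda>c. c\<^sup>2) ` D)" using D(1) finite_imageD by blast
  ultimately have "P = 0" using poly_roots_finite finite_subset by blast
  then have co: "(1 - K\<^sup>2) * (a * e)\<^sup>2 = 0" "(1 - K\<^sup>2) * (b * f)\<^sup>2 = 0"
    "2 * (a * e) * (b * f) = K\<^sup>2 * ((a * f)\<^sup>2 + (b * e)\<^sup>2)"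
    unfolding P_def by (auto simp: algebra_simps)
  have n: "a\<^sup>2 + b\<^sup>2 = 1" "e\<^sup>2 + f\<^sup>2 = 1" using pq unfolding ab pair_in_unit_circle by auto
  show ?thesis
  proof (cases "K\<^sup>2 = 1")
    \<comment> \<open>The middle coefficient is now \<open>- (a * f - b * e)\<^sup>2\<close>, so its
      vanishing makes \<open>p\<close> and \<open>q\<close> parallel unit vectors.\<close>
    case True
    then have "(a * f - b * e)\<^sup>2 = 0" using co(3) by (simp add: power2_eq_square algebra_simps)
    then have det: "a * f = b * e" by simp
    have "(a * e + b * f)\<^sup>2 = 1" using n det by algebra
    then have "a * e + b * f = 1 \<or> a * e + b * f = - 1" by (simp add: power2_eq_1_iff)
    then show ?thesis
    proof
      assume *: "a * e + b * f = 1"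
      have "(a - e)\<^sup>2 + (b - f)\<^sup>2 = 0" using * n by (simp add: power2_eq_square algebra_simps)
      then show ?thesis unfolding ab by (simp add: sum_power2_eq_zero_iff)
    next
      assume *: "a * e + b * f = - 1"
      have "(a + e)\<^sup>2 + (b + f)\<^sup>2 = 0" using * n by (simp add: power2_eq_square algebra_simps)
      then have "a + e = 0" "b + f = 0" by (simp_all only: sum_power2_eq_zero_iff)
      then have "a = - e" "b = - f" by linarith+
      then show ?thesis unfolding ab by simp
    qed
  next
    \<comment> \<open>The outer coefficients now force \<open>a * e = 0\<close> and
      \<open>b * f = 0\<close>. A unit vector has no two zero coordinates, so both points lie on the
      axes.\<close>
    case False
    then have "a * e = 0" "b * f = 0" using co(1,2) by auto
    then show ?thesis using n unfolding ab by auto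
  qed
qed

section \<open>Half circles and finite sets in the circle\<close>

text \<open>Radial projection is continuous away from the origin and maps the connected cone onto
  its part on the sphere.\<close>

lemma connected_cone_Int_sphere:
  fixes A :: "'a::real_normed_vector set"
  assumes "convex A" "0 \<notin> A" "\<And>x t. x \<in> A \<Longrightarrow> 0 < t \<Longrightarrow> t *\<^sub>R x \<in> A"
  shows "connected (A \<inter> sphere 0 1)"
proof -
  have "connected ((\<lambda>x. x /\<^sub>R norm x) ` A)"
    using assms(1,2)
    by (intro connected_continuous_image convex_connected continuous_intros) auto
  moreover have "(\<lambda>x. x /\<^sub>R norm x) ` A = A \<inter> sphere 0 1"
  proof
    show "(\<lambda>x. x /\<^sub>R norm x) ` A \<subseteq> A \<inter> sphere 0 1"
    proof
      fix y assume "y \<in> (\<lambda>x. x /\<^sub>R norm x) ` A"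
      then obtain x where x: "x \<in> A" "y = x /\<^sub>R norm x" by blast
      then have "x \<noteq> 0" using assms(2) by auto
      then show "y \<in> A \<inter> sphere 0 1" using x assms(3)[of x "inverse (norm x)"] by simp
    qed
    show "A \<inter> sphere 0 1 \<subseteq> (\<lambda>x. x /\<^sub>R norm x) ` A"
      by (force simp: image_iff)
  qed
  ultimately show ?thesis by simp
qed

text \<open>An open singleton \<open>{p}\<close> would be clopen in the connected circle, which also
  contains \<open>- p\<close>. Hence singletons are nowhere dense.\<close>

lemma meagre_in_unit_circle_finite:
  assumes "finite F" "F \<subseteq> unit_circle"
  shows "meagre_in (top_of_set unit_circle) F"
proof -
  have "nowhere_dense_in (top_of_set unit_circle) {p}" if p: "p \<in> unit_circle" for p
  proof -
    let ?X = "top_of_set unit_circle"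
    have cl: "closedin ?X {p}" using p by (auto intro: closed_subset)
    have "connected unit_circle" by (rule connected_sphere) simp
    moreover have "p \<noteq> 0" using p by auto
    then have "- p \<noteq> p" by (simp add: prod_eq_iff)
    moreover have "- p \<in> unit_circle" using p by simp
    ultimately have "\<not> openin ?X {p}" using cl unfolding connected_clopen by blast
    moreover have "?X interior_of {p} \<subseteq> {p}" by (rule interior_of_subset)
    ultimately have "?X interior_of {p} = {}"
      by (metis openin_interior_of subset_singletonD)
    then show ?thesis unfolding nowhere_dense_in_def using p closure_of_closedin[OF cl] by simp
  qed
  then show ?thesis unfolding meagre_in_def using assms countable_finite[of "(\<lambda>p. {p}) ` F"]
    by (intro exI[of _ "(\<lambda>p. {p}) ` F"]) auto
qed

text \<open>Removing \<open>p\<close> and \<open>- p\<close> leaves two open half circles without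
  boundary points of \<open>I\<close>. One of them meets \<open>I\<close>, hence lies in it, and the
  symmetry of \<open>W\<close> supplies the other.\<close>

lemma unit_circle_minus_antipodes_subset:
  assumes W: "I \<subseteq> W" "W \<subseteq> unit_circle" "openin (top_of_set unit_circle) I" "uminus ` W = W"
    and p: "p \<in> closure I - I" "closure I - I \<subseteq> {p, - p}" "p \<in> unit_circle"
  shows "unit_circle - {p, - p} \<subseteq> W"
proof -
  obtain a b where ab: "p = (a, b)" by (cases p)
  have n: "a\<^sup>2 + b\<^sup>2 = 1" using p(3) unfolding ab pair_in_unit_circle .
  define h where "h v = {x. 0 < inner v x} \<inter> unit_circle" for v :: "real \<times> real"
  \<comment> \<open>This is \<open>p\<close> turned by a right angle, a normal of the line through
    \<open>p\<close> and \<open>- p\<close>. Thus \<open>h w\<close> and \<open>h (- w)\<close> are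
    the two half circles.\<close>
  define w where "w = (- b, a)"
  have perp: "x = p \<or> x = - p" if x: "x \<in> unit_circle" "inner w x = 0" for x
  proof -
    obtain u v where uv: "x = (u, v)" by (cases x)
    have "u\<^sup>2 + v\<^sup>2 = 1" using x(1) unfolding uv pair_in_unit_circle .
    moreover have det: "a * v = b * u" using x(2) unfolding w_def uv by simp
    ultimately have "(a * u + b * v)\<^sup>2 = 1" using n by algebra
    then have "a * u + b * v = 1 \<or> a * u + b * v = - 1" by (simp add: power2_eq_1_iff)
    moreover have "u = (a * u + b * v) * a" "v = (a * u + b * v) * b"
      using n det by algebra+
    ultimately show ?thesis unfolding uv ab by auto
  qed
  have conn: "connected (h v)" for v
    unfolding h_def by (rule connected_cone_Int_sphere) (auto simp: convex_halfspace_gt)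
  have "inner w p = 0" unfolding w_def ab by simp
  then have hI: "h v \<subseteq> I" if "v = w \<or> v = - w" "h v \<inter> I \<noteq> {}" for v
    using that p(2) conn[of v]
    by (intro connected_subset_of_disjoint_boundary[OF W(3)]) (auto simp: h_def)
  have neg: "h v \<subseteq> W" if "h (- v) \<subseteq> W" for v
  proof
    fix x assume "x \<in> h v"
    then have "- x \<in> h (- v)" unfolding h_def by auto
    then have "- x \<in> W" using that by blast
    then show "x \<in> W" using W(4) by (metis add.inverse_inverse image_eqI)
  qed
  \<comment> \<open>A point of \<open>I\<close> off \<open>{p, - p}\<close> is needed. Since
    \<open>p\<close> is not in \<open>I\<close>, only \<open>I = {- p}\<close> could prevent this,
    but that set is closed and has no boundary point outside itself.\<close>
  have "I \<noteq> {- p}" using p(1) by auto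
  moreover have "I \<noteq> {}" using p(1) by auto
  ultimately obtain x where x: "x \<in> I" "x \<noteq> - p" by blast
  then have "x \<noteq> p" "x \<in> unit_circle" using p(1) W by auto
  then have "inner w x \<noteq> 0" using perp x by blast
  then have "x \<in> h w \<or> x \<in> h (- w)" using \<open>x \<in> unit_circle\<close> unfolding h_def by auto
  then have "h w \<subseteq> W \<or> h (- w) \<subseteq> W" using hI[of w] hI[of "- w"] x W(1) by blast
  then have both: "h w \<subseteq> W" "h (- w) \<subseteq> W" using neg[of w] neg[of "- w"] by auto
  show ?thesis
  proof
    fix y assume y: "y \<in> unit_circle - {p, - p}"
    then have "inner w y \<noteq> 0" using perp by blast
    then have "y \<in> h w \<or> y \<in> h (- w)" using y unfolding h_def by auto
    then show "y \<in> W" using both by blast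
  qed
qed

section \<open>Rigid sets and the quarter arcs\<close>

theorem theorem5p3:
  fixes H :: "(real \<times> real) set" and C :: "real set"
  assumes "Baire_property_in (top_of_set unit_circle) H"
    and "rigid_for H C"
    and "uncountable C"
  shows "\<forall>Q\<in>quarter_arcs. meagre_in (top_of_set unit_circle) (H \<inter> Q) \<or>
           meagre_in (top_of_set unit_circle) (Q - H)"
proof
  fix Q :: "(real \<times> real) set" assume "Q \<in> quarter_arcs"
  then obtain s t :: real where "s \<in> {- 1, 1}" "t \<in> {- 1, 1}"
    and Q: "Q = {(x, y). (x, y) \<in> unit_circle \<and> 0 \<le> s * x \<and> 0 \<le> t * y}"
    unfolding quarter_arcs_def by blast
  then have st: "s \<noteq> 0" "t \<noteq> 0" by auto
  let ?X = "top_of_set unit_circle"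
  define W where "W = open_core ?X H"
  have HS: "H \<subseteq> unit_circle" and Hneg: "uminus ` H = H" and Cpos: "C \<subseteq> {0<..}"
    and rig: "\<And>c. c \<in> C \<Longrightarrow> \<exists>\<alpha>. H = rotation \<alpha> ` psi c ` H"
    using assms(2) unfolding rigid_for_def by auto
  have opW: "openin ?X W" unfolding W_def by (rule openin_open_core)
  then have WS: "W \<subseteq> unit_circle" using openin_imp_subset by blast
  have WH: "meagre_in ?X (W - H)" unfolding W_def by (rule meagre_open_core_diff)
  have HW: "meagre_in ?X (H - W)" unfolding W_def by (rule meagre_diff_open_core[OF assms(1)])
  have inv: "f ` W = W" if "homeomorphism unit_circle unit_circle f g" "f ` H = H" for f g
    unfolding W_def using open_core_invariant[OF homeomorphism_imp_homeomorphic_map[OF that(1)]]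
      HS that(2) by simp
  have "homeomorphism unit_circle unit_circle uminus uminus"
    by (intro homeomorphismI continuous_intros image_subsetI) simp_all
  then have Wneg: "uminus ` W = W" using inv Hneg by blast
  have opI: "openin ?X I" if "I \<in> components W" for I
    using openin_components_locally_connected[OF locally_open_subset[OF locally_connected_sphere opW] that]
      opW openin_trans by blast
  define bd where "bd I = closure I - I" for I :: "(real \<times> real) set"
  have IS: "I \<subseteq> unit_circle" if "I \<in> components W" for I
    using in_components_subset[OF that] WS by blast
  have bdS: "bd I \<subseteq> unit_circle" if "I \<in> components W" for I
    using IS[OF that] closure_minimal[of I unit_circle] unfolding bd_def by auto
  \<comment> \<open>All inner products of two boundary points of a common component: finitely many
    for each of countably many components.\<close>
  define B where "B = (\<Union>J\<in>components W. (\<lambda>(a, b). inner a b) ` (bd J \<times> bd J))"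
  have "countable (bd J)" if "J \<in> components W" for J
    unfolding bd_def
    using finite_boundary_connected_subset_unit_circle[OF in_components_connected IS] that
    by (intro countable_finite) blast
  then have cB: "countable B"
    unfolding B_def
    using countable_components_openin[OF locally_connected_sphere opW] by blast
  have axis: "p = q \<or> p = - q \<or> (fst p = 0 \<or> snd p = 0) \<and> (fst q = 0 \<or> snd q = 0)"
    if I: "I \<in> components W" and pq: "p \<in> bd I" "q \<in> bd I" for I p q
  proof -
    \<comment> \<open>The map \<open>g\<close> sends \<open>I\<close> to a component and boundary
      points to boundary points, and its rotation factor cancels in the inner product.\<close>
    have inB: "inner (psi c p) (psi c q) \<in> B" if c: "c \<in> C" for c
    proof -
      obtain \<alpha> where \<alpha>: "H = rotation \<alpha> ` psi c ` H" using rig[OF c] by blast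
      define g where "g = rotation \<alpha> \<circ> psi c"
      obtain g' where g: "homeomorphism unit_circle unit_circle g g'"
        using homeomorphism_compose[OF homeomorphism_psi homeomorphism_rotation] c Cpos
        unfolding g_def by blast
      have "g ` W = W" using inv[OF g] \<alpha> by (simp add: g_def image_comp)
      then have J: "g ` I \<in> components W"
        using components_homeomorphic_image[OF g WS _ I] by blast
      have "g p \<in> bd (g ` I)" "g q \<in> bd (g ` I)"
        using closure_diff_homeomorphic_image[OF g closed_sphere IS[OF I]] pq
        unfolding bd_def by auto
      then have "inner (g p) (g q) \<in> B" unfolding B_def using J by force
      then show ?thesis unfolding g_def by (simp add: inner_rotation)
    qed
    \<comment> \<open>Pigeonhole: the uncountable set \<open>C\<close> is covered by the level sets
      belonging to the countably many values in \<open>B\<close>.\<close>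
    obtain K where "uncountable {c \<in> C. inner (psi c p) (psi c q) = K}"
    proof (rule ccontr)
      assume "\<not> thesis"
      then have "\<And>K. countable {c \<in> C. inner (psi c p) (psi c q) = K}" using that by blast
      then have "countable (\<Union>K\<in>B. {c \<in> C. inner (psi c p) (psi c q) = K})"
        using cB by blast
      moreover have "C \<subseteq> (\<Union>K\<in>B. {c \<in> C. inner (psi c p) (psi c q) = K})" using inB by auto
      ultimately show False using assms(3) countable_subset by blast
    qed
    then have "infinite {c \<in> C. inner (psi c p) (psi c q) = K}"
      using countable_finite by blast
    then show ?thesis
      by (rule inner_psi_constant_cases) (use Cpos bdS[OF I] pq in auto)
  qed
  \<comment> \<open>The open quarter arc. Up to the meagre set \<open>A\<close> of axis points it
    contains \<open>Q\<close>, and unlike \<open>Q\<close> it avoids the axes.\<close>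
  define T where "T = {z. 0 < s * fst z \<and> 0 < t * snd z} \<inter> unit_circle"
  define A :: "(real \<times> real) set" where "A = {(1, 0), (- 1, 0), (0, 1), (0, - 1)}"
  have mA: "meagre_in ?X A"
    unfolding A_def by (rule meagre_in_unit_circle_finite) (auto simp: norm_Pair)
  have QT: "Q \<subseteq> T \<union> A"
  proof
    fix z assume z: "z \<in> Q"
    obtain x y where xy: "z = (x, y)" by (cases z)
    have n: "x\<^sup>2 + y\<^sup>2 = 1" "0 \<le> s * x" "0 \<le> t * y"
      using z unfolding Q xy by (auto simp flip: pair_in_unit_circle)
    show "z \<in> T \<union> A"
    proof (cases "x = 0 \<or> y = 0")
      case True
      then show ?thesis using n unfolding xy A_def by (auto simp: power2_eq_1_iff)
    next
      case False
      then have "0 < s * x" "0 < t * y" using n st by (auto simp: order_less_le)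
      then show ?thesis using z unfolding T_def xy Q by auto
    qed
  qed
  have cT: "connected T"
  proof -
    have "{z. 0 < s * fst z \<and> 0 < t * snd z}
        = {z. 0 < inner (s, 0) z} \<inter> {z. 0 < inner (0, t) z}"
      by (auto simp: inner_prod_def)
    then have "convex {z :: real \<times> real. 0 < s * fst z \<and> 0 < t * snd z}"
      by (simp add: convex_Int convex_halfspace_gt)
    then show ?thesis
      unfolding T_def by (rule connected_cone_Int_sphere) (auto simp: mult.left_commute)
  qed
  have "T \<inter> W = {} \<or> T \<subseteq> W \<or> (\<exists>F. finite F \<and> F \<subseteq> unit_circle \<and> unit_circle - F \<subseteq> W)"
  proof (cases "T \<inter> W = {}")
    case False
    then obtain x where x: "x \<in> T" "x \<in> W" by blast
    then obtain I where I: "I \<in> components W" "x \<in> I" by (metis UnionE Union_components)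
    have IW: "I \<subseteq> W" using in_components_subset[OF I(1)] .
    show ?thesis
    proof (cases "T \<inter> bd I = {}")
      case True
      then have "T \<subseteq> I"
        using connected_subset_of_disjoint_boundary[OF opI[OF I(1)] _ cT] x I(2)
        unfolding bd_def T_def by blast
      then show ?thesis using IW by blast
    next
      case False
      then obtain p where p: "p \<in> T" "p \<in> bd I" by blast
      then have "fst p \<noteq> 0" "snd p \<noteq> 0" unfolding T_def by auto
      \<comment> \<open>Since \<open>p\<close> is off the axes, the axis alternative is excluded for
        every other boundary point of \<open>I\<close>.\<close>
      then have "bd I \<subseteq> {p, - p}" using axis[OF I(1) p(2)] by force
      then have "unit_circle - {p, - p} \<subseteq> W"
        using unit_circle_minus_antipodes_subset[OF IW WS opI[OF I(1)] Wneg] p(2) bdS[OF I(1)]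
        unfolding bd_def by blast
      moreover have "p \<in> unit_circle" using p(2) bdS[OF I(1)] by blast
      then have "{p, - p} \<subseteq> unit_circle" by simp
      ultimately show ?thesis by (metis finite.emptyI finite_insert)
    qed
  qed blast
  then consider "T \<inter> W = {}" | "T \<subseteq> W"
    | F where "finite F" "F \<subseteq> unit_circle" "unit_circle - F \<subseteq> W" by blast
  then show "meagre_in ?X (H \<inter> Q) \<or> meagre_in ?X (Q - H)"
  \<comment> \<open>In each case \<open>W\<close> decides the arc up to a meagre set, and
    \<open>W\<close> differs from \<open>H\<close> by the meagre sets \<open>W - H\<close> and
    \<open>H - W\<close>.\<close>
  proof cases
    case 1
    then have "H \<inter> Q \<subseteq> A \<union> (H - W)" using QT by blast
    then show ?thesis using meagre_in_subset[OF meagre_in_Un[OF mA HW]] by simp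
  next
    case 2
    then have "Q - H \<subseteq> A \<union> (W - H)" using QT by blast
    then show ?thesis using meagre_in_subset[OF meagre_in_Un[OF mA WH]] by simp
  next
    case 3
    then have "Q - H \<subseteq> F \<union> (W - H)" unfolding Q by blast
    then show ?thesis
      using meagre_in_subset[OF meagre_in_Un[OF meagre_in_unit_circle_finite[OF 3(1,2)] WH]]
      by simp
  qed
qed

end
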